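(* Let $0<\alpha<1$, let $A=\begin{bmatrix}a&b\\-b&a\end{bmatrix}$ with $a,b\in\mathbb{R}$, let $c_1,c_2\in\mathbb{R}$ and $t_1>0$. Let $X$ be the solution of ${}_0^C\mathrm{D}_t^\alpha X(t)=AX(t)$ with $X(0)=(c_1,c_2)^T$, and let $Y$ be the solution of ${}_0^C\mathrm{D}_t^\alpha Y(t)=AY(t)$ with $Y(0)=X(t_1)$. Let $\nu_1,T_1,N_1,\kappa_1$ (respectively $\nu_2,T_2,N_2,\kappa_2$) be the speed, unit tangent, unit normal and curvature of the curve $X$ (respectively $Y$). Put $w=E_\alpha((a+ib)t_1^\alpha)\in\mathbb{C}$ and, for $t>0$, $$c_\alpha(t)=\sum_{n=1}^\infty\frac{\mathrm{Re}((a+ib)^n)\,t^{\alpha n-1}}{\Gamma(\alpha n)},\qquad s_\alpha(t)=\sum_{n=1}^\infty\frac{\mathrm{Im}((a+ib)^n)\,t^{\alpha n-1}}{\Gamma(\alpha n)},$$ $$u_3(t)=(c_1^2+c_2^2)\left(-c_\alpha(t)\sum_{n=1}^\infty\frac{\mathrm{Im}((a+ib)^n)(\alpha n-1)t^{\alpha n-2}}{\Gamma(\alpha n)}+s_\alpha(t)\sum_{n=1}^\infty\frac{\mathrm{Re}((a+ib)^n)(\alpha n-1)t^{\alpha n-2}}{\Gamma(\alpha n)}\right).$$ Then $$X(t)=\begin{bmatrix}c_1\mathrm{Re}[E_\alpha((a+ib)t^\alpha)]+c_2\mathrm{Im}[E_\alpha((a+ib)t^\alpha)]\\-c_1\mathrm{Im}[E_\alpha((a+ib)t^\alpha)]+c_2\mathrm{Re}[E_\alpha((a+ib)t^\alpha)]\end{bmatrix},\qquad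 Y(t)=\begin{bmatrix}p\,\mathrm{Re}[E_\alpha((a+ib)t^\alpha)]+q\,\mathrm{Im}[E_\alpha((a+ib)t^\alpha)]\\-p\,\mathrm{Im}[E_\alpha((a+ib)t^\alpha)]+q\,\mathrm{Re}[E_\alpha((a+ib)t^\alpha)]\end{bmatrix},$$ where $p=c_1\mathrm{Re}\,w+c_2\mathrm{Im}\,w$ and $q=-c_1\mathrm{Im}\,w+c_2\mathrm{Re}\,w$; for all $t>0$, $$\nu_1(t)=\sqrt{c_1^2+c_2^2}\,\bigl(c_\alpha(t)^2+s_\alpha(t)^2\bigr)^{1/2},\qquad \nu_2(t)=\sqrt{c_1^2+c_2^2}\,|w|\bigl(c_\alpha(t)^2+s_\alpha(t)^2\bigr)^{1/2}=|w|\,\nu_1(t);$$ and at every $t>0$ with $\nu_1(t)\neq0$ and $\nu_2(t)\neq0$, $$\kappa_1=\left|\frac{u_3(t)}{\nu_1(t)^3}\right|,\qquad \kappa_2=\frac{1}{|w|}\kappa_1,$$ $$T_1=\frac{1}{\nu_1}\bigl(c_1c_\alpha+c_2s_\alpha,\;-c_1s_\alpha+c_2c_\alpha\bigr),\qquad N_1=\frac{1}{\nu_1}\bigl(c_1s_\alpha-c_2c_\alpha,\;c_1c_\alpha+c_2s_\alpha\bigr),$$ $$T_2=\frac{\mathrm{Re}(w)\,\nu_1}{\nu_2}T_1-\frac{\mathrm{Im}(w)\,\nu_1}{\nu_2}N_1,\qquad N_2=\frac{\mathrm{Re}(w)\,\nu_1}{\nu_2}N_1+\frac{\mathrm{Im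}(w)\,\nu_1}{\nu_2}T_1.$$
   Context: The Caputo derivative of order $\alpha\in(0,1)$ is ${}_0^{C}\mathrm{D}_t^\alpha f(t)=\frac{1}{\Gamma(1-\alpha)}\int_0^t (t-\tau)^{-\alpha}f'(\tau)\,d\tau$ for $t>0$, applied componentwise. A solution of ${}_0^C\mathrm{D}_t^\alpha X=AX$ is a function continuous on $[0,\infty)$, continuously differentiable on $(0,\infty)$ with derivative integrable near $0$, satisfying the equation for all $t>0$. It is known that the solution with $X(0)=X_0$ is $X(t)=E_\alpha(At^\alpha)X_0$. The Mittag-Leffler function is $E_\alpha(z)=\sum_{k=0}^\infty \frac{z^k}{\Gamma(\alpha k+1)}$ (also for matrix arguments). For a planar curve $(x(t),y(t))$, twice differentiable for $t>0$, the speed is $\nu=\sqrt{\dot x^2+\dot y^2}$, and where $\nu\neq0$ the unit tangent is $T=(\dot x,\dot y)/\nu$, the unit normal is $N=(-\dot y,\dot x)/\nu$, and the curvature is taken unsigned: $\kappa=|\dot x\ddot y-\dot y\ddot x|/\nu^3$. *)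

theory Defs
  imports "HOL-Analysis.Analysis"
begin

definition mittag_leffler :: "real \<Rightarrow> complex \<Rightarrow> complex" where
  "mittag_leffler \<alpha> z = (\<Sum>k. z ^ k / complex_of_real (Gamma (\<alpha> * real k + 1)))"

definition caputo :: "real \<Rightarrow> (real \<Rightarrow> real) \<Rightarrow> real \<Rightarrow> real" where
  "caputo \<alpha> f t =
     1 / Gamma (1 - \<alpha>) * (LBINT \<tau>:{0<..<t}. (t - \<tau>) powr (-\<alpha>) * deriv f \<tau>)"

definition caputo_vec :: "real \<Rightarrow> (real \<Rightarrow> real^'n) \<Rightarrow> real \<Rightarrow> real^'n" where
  "caputo_vec \<alpha> X t = (\<chi> i. caputo \<alpha> (\<lambda>s. X s $ i) t)"

text \<open>Functions on the half-line are total functions on the reals whose values at negative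
  arguments are irrelevant. The regularity clauses make the integrand of \<^const>\<open>caputo\<close>
  Lebesgue integrable on the interval from 0 to t for every positive t.\<close>

definition caputo_solution :: "real \<Rightarrow> real^'n^'n \<Rightarrow> (real \<Rightarrow> real^'n) \<Rightarrow> bool" where
  "caputo_solution \<alpha> A X \<longleftrightarrow>
     continuous_on {0..} X \<and>
     X C1_differentiable_on {0<..} \<and>
     (\<exists>\<delta>>0. set_integrable lborel {0<..\<delta>} (\<lambda>t. vector_derivative X (at t))) \<and>
     (\<forall>t>0. caputo_vec \<alpha> X t = A *v X t)"

definition twice_differentiable_curve :: "(real \<Rightarrow> real^2) \<Rightarrow> bool" where
  "twice_differentiable_curve X \<longleftrightarrow>
     (\<forall>t>0. \<forall>i. (\<lambda>s. X s $ i) differentiable (at t) \<and>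
                deriv (\<lambda>s. X s $ i) differentiable (at t))"

definition speed :: "(real \<Rightarrow> real^2) \<Rightarrow> real \<Rightarrow> real" where
  "speed X t = sqrt ((deriv (\<lambda>s. X s $ 1) t)\<^sup>2 + (deriv (\<lambda>s. X s $ 2) t)\<^sup>2)"

definition unit_tangent :: "(real \<Rightarrow> real^2) \<Rightarrow> real \<Rightarrow> real^2" where
  "unit_tangent X t =
     (1 / speed X t) *\<^sub>R vector [deriv (\<lambda>s. X s $ 1) t, deriv (\<lambda>s. X s $ 2) t]"

definition unit_normal :: "(real \<Rightarrow> real^2) \<Rightarrow> real \<Rightarrow> real^2" where
  "unit_normal X t =
     (1 / speed X t) *\<^sub>R vector [- deriv (\<lambda>s. X s $ 2) t, deriv (\<lambda>s. X s $ 1) t]"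

definition curvature :: "(real \<Rightarrow> real^2) \<Rightarrow> real \<Rightarrow> real" where
  "curvature X t =
     \<bar>deriv (\<lambda>s. X s $ 1) t * deriv (deriv (\<lambda>s. X s $ 2)) t
      - deriv (\<lambda>s. X s $ 2) t * deriv (deriv (\<lambda>s. X s $ 1)) t\<bar> / speed X t ^ 3"

text \<open>The series below start at \<open>n = 1\<close>; their summation index is shifted by one.\<close>

definition c_series :: "real \<Rightarrow> complex \<Rightarrow> real \<Rightarrow> real" where
  "c_series \<alpha> z t =
     (\<Sum>n. Re (z ^ Suc n) * t powr (\<alpha> * real (Suc n) - 1) / Gamma (\<alpha> * real (Suc n)))"

definition s_series :: "real \<Rightarrow> complex \<Rightarrow> real \<Rightarrow> real" where
  "s_series \<alpha> z t =
     (\<Sum>n. Im (z ^ Suc n) * t powr (\<alpha> * real (Suc n) - 1) / Gamma (\<alpha> * real (Suc n)))"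

definition u3 :: "real \<Rightarrow> complex \<Rightarrow> real \<Rightarrow> real \<Rightarrow> real \<Rightarrow> real" where
  "u3 \<alpha> z c1 c2 t = (c1\<^sup>2 + c2\<^sup>2) *
     (- c_series \<alpha> z t *
          (\<Sum>n. Im (z ^ Suc n) * (\<alpha> * real (Suc n) - 1) * t powr (\<alpha> * real (Suc n) - 2)
                / Gamma (\<alpha> * real (Suc n)))
      + s_series \<alpha> z t *
          (\<Sum>n. Re (z ^ Suc n) * (\<alpha> * real (Suc n) - 1) * t powr (\<alpha> * real (Suc n) - 2)
                / Gamma (\<alpha> * real (Suc n))))"

end

(*
  X_1 - i X_2 satisfies the scalar equation with coefficient z = a + ib. Applying the fractional
  integral of order \<alpha> (Fubini and the Beta integral) turns it into the Volterra equation
  f(t) - f(0) = z / \<Gamma>(\<alpha>) \<integral>_0^t (t - s)^(\<alpha>-1) f(s) ds, whose Picard iteration converges to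
  f(0) E_\<alpha>(z t^\<alpha>). Hence the two curves are C E_\<alpha>(z t^\<alpha>) and C w E_\<alpha>(z t^\<alpha>) up to
  conjugation, so Y is the image of X under multiplication by w, and all geometric data follow by
  differentiating the power series twice.
*)
theory Submission
  imports Defs "HOL-Real_Asymp.Real_Asymp"
begin

text \<open>The solution concept only gives an equation for given functions, so the explicit formula
  is a uniqueness statement. Two features shape its proof. No growth at infinity is known, which
  suits a Volterra equation on [0,t]: there continuity alone bounds the solution. And the velocity
  may blow up at 0, typically like t^(\<alpha>-1), so the fundamental theorem of calculus is used
  with a derivative on the open interval only, its integrability being a separate input. The minus
  sign in X_1 - i X_2 makes the coefficient a + ib; X_1 + i X_2 would have a - ib, and w and the
  series would enter conjugated. No Gronwall argument is needed: after n Picard steps the error is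
  at most a constant times the n-th term of the series at |z| t^\<alpha>, hence tends to 0. The
  series c_\<alpha>, s_\<alpha> contain non-integer powers of t. They are treated as t^(\<alpha>-1)
  times an entire function of z t^\<alpha>, so that termwise differentiation happens only for
  ordinary power series.\<close>

section \<open>Growth of the Gamma function and convergence of the Mittag-Leffler series\<close>

text \<open>Log-convexity of Gamma: with y = x + \<alpha> - 1, the point x is the convex combination
  (1-\<alpha>)(y+1) + \<alpha> y, and \<Gamma>(y+1) = y \<Gamma>(y) removes \<Gamma>(y). The
  hypothesis on x says y > 0. At x = \<alpha> k + 1 this controls the quotient of consecutive
  Mittag-Leffler coefficients.\<close>

lemma Gamma_shift_ge:
  fixes x \<alpha> :: real
  assumes "0 < \<alpha>" "\<alpha> < 1" "1 - \<alpha> < x"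
  shows "Gamma x * (x + \<alpha> - 1) powr \<alpha> \<le> Gamma (x + \<alpha>)"
proof -
  define y where "y = x + \<alpha> - 1"
  have y: "y > 0" "x > 0" using assms by (auto simp: y_def)
  have "(ln \<circ> Gamma) ((1 - \<alpha>) *\<^sub>R (y + 1) + \<alpha> *\<^sub>R y) \<le>
        (1 - \<alpha>) * (ln \<circ> Gamma) (y + 1) + \<alpha> * (ln \<circ> Gamma) y"
    by (rule convex_onD[OF log_convex_Gamma_real]) (use assms y in auto)
  moreover have "(1 - \<alpha>) *\<^sub>R (y + 1) + \<alpha> *\<^sub>R y = x"
    by (simp add: y_def algebra_simps)
  moreover have "ln (Gamma (y + 1)) = ln y + ln (Gamma y)"
  proof -
    have "Gamma y > 0" using y by (intro Gamma_real_pos)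
    hence "ln (y * Gamma y) = ln y + ln (Gamma y)" using y by (intro ln_mult_pos)
    thus ?thesis using y by (subst Gamma_plus1) auto
  qed
  ultimately have "ln (Gamma x) + \<alpha> * ln y \<le> ln (Gamma (y + 1))"
    by (simp add: algebra_simps)
  hence "exp (ln (Gamma x) + \<alpha> * ln y) \<le> exp (ln (Gamma (y + 1)))"
    by (simp only: exp_le_cancel_iff)
  hence "Gamma x * y powr \<alpha> \<le> Gamma (y + 1)"
    using y by (simp add: exp_add powr_def Gamma_real_pos)
  thus ?thesis by (simp add: y_def)
qed

text \<open>The ratio of consecutive terms is at most |w| (\<alpha> k + \<alpha>)^(-\<alpha>),
  eventually below 1/2. The type is left general because a complex argument is needed for the
  function itself and a real one for the error term of the Picard iteration.\<close>

lemma summable_mittag_leffler: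
  fixes w :: "'a :: {banach, real_normed_field}"
  assumes "0 < \<alpha>" "\<alpha> < 1"
  shows "summable (\<lambda>k. of_real (1 / Gamma (\<alpha> * real k + 1)) * w ^ k)"
proof -
  have "filterlim (\<lambda>k. (\<alpha> * real k + \<alpha>) powr \<alpha>) at_top sequentially"
    using assms by real_asymp
  hence "eventually (\<lambda>k. 2 * norm w \<le> (\<alpha> * real k + \<alpha>) powr \<alpha>) sequentially"
    by (simp add: filterlim_at_top)
  then obtain N where N: "\<And>k. k \<ge> N \<Longrightarrow> 2 * norm w \<le> (\<alpha> * real k + \<alpha>) powr \<alpha>"
    by (auto simp: eventually_sequentially)
  show ?thesis
  proof (rule summable_ratio_test[of "1/2" N])
    fix k assume k: "k \<ge> N"
    have pos: "Gamma (\<alpha> * real k + 1) > 0" "Gamma (\<alpha> * real (Suc k) + 1) > 0"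
      using assms by (auto intro!: Gamma_real_pos add_nonneg_pos)
    have "Gamma (\<alpha> * real k + 1) * (2 * norm w)
          \<le> Gamma (\<alpha> * real k + 1) * (\<alpha> * real k + \<alpha>) powr \<alpha>"
      using N[OF k] pos by (intro mult_left_mono) auto
    also have "\<dots> \<le> Gamma (\<alpha> * real (Suc k) + 1)"
      using Gamma_shift_ge[of \<alpha> "\<alpha> * real k + 1"] assms
      by (simp add: algebra_simps add_nonneg_pos add_pos_nonneg)
    finally have "norm w / Gamma (\<alpha> * real (Suc k) + 1) \<le> 1/2 * (1 / Gamma (\<alpha> * real k + 1))"
      using pos by (simp add: field_simps)
    from mult_right_mono[OF this, of "norm w ^ k"]
    show "norm (of_real (1 / Gamma (\<alpha> * real (Suc k) + 1)) * w ^ Suc k)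
          \<le> 1/2 * norm (of_real (1 / Gamma (\<alpha> * real k + 1)) * w ^ k)"
      using pos by (simp add: norm_mult norm_power norm_divide mult_ac)
  qed auto
qed

subsection \<open>Fractional integration of the Caputo derivative\<close>

lemma has_bochner_integral_Beta_shifted:
  fixes a b u v :: real
  assumes "0 < a" "0 < b" "u < v"
  shows "has_bochner_integral lborel
           (\<lambda>s. indicator {u<..<v} s * ((v - s) powr (a - 1) * (s - u) powr (b - 1)))
           (Beta b a * (v - u) powr (a + b - 1))"
proof -
  define c where "c = v - u"
  have c: "c > 0" using assms by (simp add: c_def)
  have si: "set_integrable lborel {0<..<1} (\<lambda>t. t powr (b - 1) * (1 - t) powr (a - 1))"
    by (rule set_integrable_subset[OF integrable_Beta]) (use assms in auto)
  have "(LBINT t:{0<..<1}. t powr (b - 1) * (1 - t) powr (a - 1)) = Beta b a"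
    using set_borel_integral_eq_integral(2)[OF si] has_integral_Beta_real[of b a] assms
    by (simp add: has_integral_Icc_iff_Ioo integral_unique)
  with si have "has_bochner_integral lborel
      (\<lambda>t. indicator {0<..<1} t * (t powr (b - 1) * (1 - t) powr (a - 1))) (Beta b a)"
    by (simp add: has_bochner_integral_iff set_integrable_def set_lebesgue_integral_def)
  \<comment> \<open>Under s = u + c t the two kernel factors release \<open>c powr (a - 1)\<close>
    and \<open>c powr (b - 1)\<close>; the Jacobian c later raises the exponent to a + b -
    1.\<close>
  from has_bochner_integral_mult_right[OF this, of "c powr (a + b - 2)"]
  have *: "has_bochner_integral lborel
      (\<lambda>t. c powr (a + b - 2) * (indicator {0<..<1} t * (t powr (b - 1) * (1 - t) powr (a - 1))))
      (c powr (a + b - 2) * Beta b a)"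
    by simp
  have eq: "c powr (a + b - 2) * (indicator {0<..<1} t * (t powr (b - 1) * (1 - t) powr (a - 1))) =
        indicator {u<..<v} (u + c * t) *
          ((v - (u + c * t)) powr (a - 1) * ((u + c * t) - u) powr (b - 1))" for t
  proof (cases "t \<in> {0<..<1}")
    case True
    have "v - (u + c * t) = c * (1 - t)" by (simp add: c_def algebra_simps)
    moreover have "u + c * t < v"
      using True c \<open>v - (u + c * t) = c * (1 - t)\<close>
      by (metis diff_gt_0_iff_gt greaterThanLessThan_iff mult_pos_pos)
    moreover have "c powr (a + b - 2) = c powr (a - 1) * c powr (b - 1)"
      by (simp flip: powr_add add: algebra_simps)
    ultimately show ?thesis using True c by (simp add: powr_mult)
  next
    case False
    have "u + c * t \<notin> {u<..<v}"
    proof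
      assume "u + c * t \<in> {u<..<v}"
      hence "u < u + c * t" "u + c * t < v" by simp_all
      hence "c * 0 < c * t" "c * t < c * 1" using c_def by linarith+
      with c False show False by (simp only: mult_less_cancel_left_pos) simp
    qed
    thus ?thesis using False by simp
  qed
  have "(c powr (a + b - 2) * Beta b a) = (Beta b a * (v - u) powr (a + b - 1)) /\<^sub>R \<bar>c\<bar>"
    using c by (simp add: c_def[symmetric] powr_diff field_simps powr_add power2_eq_square)
  with * show ?thesis
    unfolding eq using c
    by (subst lborel_has_bochner_integral_real_affine_iff[of c _ _ u]) auto
qed

lemma set_integrable_Beta_shifted:
  fixes a b u v :: real
  assumes "0 < a" "0 < b" "u < v"
  shows "set_integrable lborel {u<..<v} (\<lambda>s. (v - s) powr (a - 1) * (s - u) powr (b - 1))"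
  using has_bochner_integral_Beta_shifted[OF assms]
  by (simp add: has_bochner_integral_iff set_integrable_def)

text \<open>The gauge integral needs the derivative only in the interior, so \<open>D\<close> may be
  unbounded near 0; the assumed absolute integrability then identifies that integral with the
  Lebesgue integral.\<close>

lemma LBINT_eq_FTC:
  fixes f D :: "real \<Rightarrow> real"
  assumes "0 < t" and "continuous_on {0..t} f"
    and "\<And>s. 0 < s \<Longrightarrow> s < t \<Longrightarrow> (f has_real_derivative D s) (at s)"
    and "set_integrable lborel {0<..<t} D"
  shows "(LBINT s:{0<..<t}. D s) = f t - f 0"
proof -
  have "(D has_integral (f t - f 0)) {0..t}"
    by (rule fundamental_theorem_of_calculus_interior)
       (use assms in \<open>auto simp: has_real_derivative_iff_has_vector_derivative\<close>)
  thus ?thesis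
    using set_borel_integral_eq_integral(2)[OF assms(4)]
    by (simp add: has_integral_Icc_iff_Ioo integral_unique)
qed

text \<open>After exchanging the integrals, the kernel (t-s)^(\<alpha>-1) (s-\<tau>)^(-\<alpha>) is
  integrated over s from \<tau> to t. The exponents add up to -1, so the value is the constant
  \<Gamma>(\<alpha>) \<Gamma>(1-\<alpha>), independent of \<tau>, and only the integral of f'
  remains.\<close>

lemma fractional_integral_caputo:
  fixes f D :: "real \<Rightarrow> real"
  assumes \<alpha>: "0 < \<alpha>" "\<alpha> < 1" and t: "0 < t"
    and f: "continuous_on {0..t} f"
      "\<And>s. 0 < s \<Longrightarrow> s < t \<Longrightarrow> (f has_real_derivative D s) (at s)"
    and D: "set_integrable lborel {0<..<t} D"
  shows "(LBINT s:{0<..<t}. (t - s) powr (\<alpha> - 1) * caputo \<alpha> f s) = Gamma \<alpha> * (f t - f 0)"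
proof -
  \<comment> \<open>Extending \<open>D\<close> by zero gives a function measurable on the whole
    line, although \<open>deriv f\<close> is controlled only on the open interval.\<close>
  define d where "d = (\<lambda>\<tau>. indicator {0<..<t} \<tau> * D \<tau>)"
  define F where "F = (\<lambda>\<tau> s. if \<tau> < s \<and> s < t
      then (t - s) powr (\<alpha> - 1) * (s - \<tau>) powr (- \<alpha>) * d \<tau> else 0)"
  define G where "G = Gamma \<alpha> * Gamma (1 - \<alpha>)"
  have Gpos: "Gamma \<alpha> > 0" "Gamma (1 - \<alpha>) > 0" "G > 0"
    using \<alpha> by (auto simp: G_def Gamma_real_pos)
  have d: "integrable lborel d" using D by (simp add: d_def set_integrable_def)
  have [measurable]: "d \<in> borel_measurable borel"
    using borel_measurable_integrable[OF d] by simp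
  have meas: "case_prod F \<in> borel_measurable (lborel \<Otimes>\<^sub>M lborel)"
    unfolding F_def by measurable
  have inner: "has_bochner_integral lborel (F \<tau>) (d \<tau> * G)" for \<tau>
  proof (cases "\<tau> \<in> {0<..<t}")
    case True
    hence "has_bochner_integral lborel
        (\<lambda>s. d \<tau> * (indicator {\<tau><..<t} s * ((t - s) powr (\<alpha> - 1) * (s - \<tau>) powr ((1 - \<alpha>) - 1))))
        (d \<tau> * (Beta (1 - \<alpha>) \<alpha> * (t - \<tau>) powr (\<alpha> + (1 - \<alpha>) - 1)))"
      using \<alpha> by (intro has_bochner_integral_mult_right has_bochner_integral_Beta_shifted) auto
    also have "(\<lambda>s. d \<tau> * (indicator {\<tau><..<t} s * ((t - s) powr (\<alpha> - 1) *
        (s - \<tau>) powr ((1 - \<alpha>) - 1)))) = F \<tau>"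
      by (auto simp: F_def indicator_def fun_eq_iff)
    also have "d \<tau> * (Beta (1 - \<alpha>) \<alpha> * (t - \<tau>) powr (\<alpha> + (1 - \<alpha>) - 1)) = d \<tau> * G"
      using True by (simp add: Beta_def G_def)
    finally show ?thesis .
  next
    case False
    hence "d \<tau> = 0" "F \<tau> = (\<lambda>s. 0)" by (auto simp: F_def d_def)
    thus ?thesis by (simp add: has_bochner_integral_zero)
  qed
  \<comment> \<open>The kernel is nonnegative and \<tau> is fixed, so the absolute value costs only
    the sign of \<open>d \<tau>\<close>, and \<open>inner\<close> already yields the absolute
    integrability that Fubini requires.\<close>
  have inner_norm: "(LBINT s. norm (F \<tau> s)) = norm (d \<tau>) * G" for \<tau>
  proof -
    have "(\<lambda>s. norm (F \<tau> s)) = (\<lambda>s. sgn (d \<tau>) * F \<tau> s)"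
      by (auto simp: F_def fun_eq_iff abs_mult sgn_if)
    hence "(LBINT s. norm (F \<tau> s)) = sgn (d \<tau>) * (d \<tau> * G)"
      using inner[of \<tau>] by (simp add: has_bochner_integral_iff)
    thus ?thesis by (auto simp: sgn_if)
  qed
  have int: "integrable (lborel \<Otimes>\<^sub>M lborel) (case_prod F)"
  proof (rule lborel_pair.Fubini_integrable[OF meas])
    show "integrable lborel (\<lambda>\<tau>. LBINT s. norm (case (\<tau>, s) of (x, xa) \<Rightarrow> F x xa))"
      using d by (simp add: inner_norm del: real_norm_def)
    show "AE \<tau> in lborel. integrable lborel (\<lambda>s. case (\<tau>, s) of (x, xa) \<Rightarrow> F x xa)"
      using inner by (auto simp: has_bochner_integral_iff)
  qed
  have outer: "(LBINT \<tau>. F \<tau> s) =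
      Gamma (1 - \<alpha>) * (indicator {0<..<t} s * ((t - s) powr (\<alpha> - 1) * caputo \<alpha> f s))" for s
  proof (cases "s \<in> {0<..<t}")
    case True
    have "(LBINT \<tau>. F \<tau> s) =
        (LBINT \<tau>. (t - s) powr (\<alpha> - 1) * (indicator {0<..<s} \<tau> * ((s - \<tau>) powr (- \<alpha>) * deriv f \<tau>)))"
      using True f(2)[THEN DERIV_imp_deriv]
      by (intro Bochner_Integration.integral_cong) (auto simp: F_def d_def indicator_def)
    also have "\<dots> = (t - s) powr (\<alpha> - 1) * (LBINT \<tau>:{0<..<s}. (s - \<tau>) powr (- \<alpha>) * deriv f \<tau>)"
      by (simp add: set_lebesgue_integral_def)
    finally show ?thesis using True Gpos by (simp add: caputo_def)
  next
    case False
    hence "F \<tau> s = 0" for \<tau> by (auto simp: F_def d_def)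
    thus ?thesis using False by simp
  qed
  have "Gamma (1 - \<alpha>) * (LBINT s:{0<..<t}. (t - s) powr (\<alpha> - 1) * caputo \<alpha> f s) =
      (LBINT s. LBINT \<tau>. F \<tau> s)"
    by (simp add: outer set_lebesgue_integral_def)
  also have "\<dots> = (LBINT \<tau>. LBINT s. F \<tau> s)"
    by (rule lborel_pair.Fubini_integral[OF int])
  also have "\<dots> = (LBINT \<tau>:{0<..<t}. D \<tau>) * G"
    using inner by (simp add: has_bochner_integral_iff d_def set_lebesgue_integral_def)
  also have "\<dots> = (f t - f 0) * G"
    using LBINT_eq_FTC[OF t f D] by simp
  finally show ?thesis using Gpos by (simp add: G_def)
qed

subsection \<open>Uniqueness for the Abel-Volterra equation\<close>

lemma set_integrable_Abel_kernel:
  fixes f :: "real \<Rightarrow> 'a :: {banach, second_countable_topology}"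
  assumes "0 < \<alpha>" "0 < t" "continuous_on {0..t} f"
  shows "set_integrable lborel {0<..<t} (\<lambda>s. (t - s) powr (\<alpha> - 1) *\<^sub>R f s)"
proof -
  have "compact (f ` {0..t})"
    using assms by (intro compact_continuous_image) auto
  then obtain M where M: "\<And>s. s \<in> {0..t} \<Longrightarrow> norm (f s) \<le> M"
    by (meson bounded_iff compact_imp_bounded imageI)
  \<comment> \<open>The dominating function is a Beta integrand with second parameter 1; its last
    factor equals 1 on the open interval.\<close>
  have "set_integrable lborel {0<..<t} (\<lambda>s. M * ((t - s) powr (\<alpha> - 1) * (s - 0) powr (1 - 1)))"
    using assms set_integrable_Beta_shifted[of \<alpha> 1 0 t] by simp
  thus ?thesis
  proof (rule set_integrable_bound)
    show "set_borel_measurable lborel {0<..<t} (\<lambda>s. (t - s) powr (\<alpha> - 1) *\<^sub>R f s)"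
      unfolding set_borel_measurable_def
      using continuous_on_subset[OF assms(3), of "{0<..<t}", OF greaterThanLessThan_subseteq_atLeastAtMost_iff[THEN iffD2]]
      by (auto simp del: scaleR_scaleR
          intro!: borel_measurable_continuous_on_indicator continuous_intros)
    show "AE s in lborel. s \<in> {0<..<t} \<longrightarrow>
        norm ((t - s) powr (\<alpha> - 1) *\<^sub>R f s) \<le>
        norm (M * ((t - s) powr (\<alpha> - 1) * (s - 0) powr (1 - 1)))"
    proof (intro AE_I2 impI)
      fix s assume s: "s \<in> {0<..<t}"
      hence "norm (f s) * (t - s) powr (\<alpha> - 1) \<le> \<bar>M\<bar> * (t - s) powr (\<alpha> - 1)"
        using M[of s] by (intro mult_right_mono) auto
      thus "norm ((t - s) powr (\<alpha> - 1) *\<^sub>R f s) \<le>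
          norm (M * ((t - s) powr (\<alpha> - 1) * (s - 0) powr (1 - 1)))"
        using s by (simp add: abs_mult mult_ac)
    qed
  qed
qed

text \<open>A Beta integral with parameters \<alpha> k + 1 and \<alpha>. The normalisation by
  \<Gamma>(\<alpha> k + 1) is exactly what makes the Abel integral move each monomial to the next
  one, so that a Picard step appends one term of the series.\<close>

lemma has_bochner_integral_Abel_powr:
  fixes \<alpha> t :: real
  assumes "0 < \<alpha>" "0 < t"
  shows "has_bochner_integral lborel
      (\<lambda>s. indicator {0<..<t} s * ((t - s) powr (\<alpha> - 1) * (s powr (\<alpha> * real k) / Gamma (\<alpha> * real k + 1))))
      (Gamma \<alpha> * (t powr (\<alpha> * real (Suc k)) / Gamma (\<alpha> * real (Suc k) + 1)))"
proof -
  have pos: "Gamma (\<alpha> * real k + 1) > 0"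
    using assms by (intro Gamma_real_pos add_nonneg_pos) auto
  have "has_bochner_integral lborel
      (\<lambda>s. (indicator {0<..<t} s * ((t - s) powr (\<alpha> - 1) * (s - 0) powr ((\<alpha> * real k + 1) - 1)))
         / Gamma (\<alpha> * real k + 1))
      ((Beta (\<alpha> * real k + 1) \<alpha> * (t - 0) powr (\<alpha> + (\<alpha> * real k + 1) - 1)) / Gamma (\<alpha> * real k + 1))"
    using assms
    by (intro has_bochner_integral_divide has_bochner_integral_Beta_shifted) (auto intro: add_nonneg_pos)
  moreover have "(Beta (\<alpha> * real k + 1) \<alpha> * (t - 0) powr (\<alpha> + (\<alpha> * real k + 1) - 1)) / Gamma (\<alpha> * real k + 1)
      = Gamma \<alpha> * (t powr (\<alpha> * real (Suc k)) / Gamma (\<alpha> * real (Suc k) + 1))"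
    using pos by (simp add: Beta_def field_simps add_ac)
  ultimately show ?thesis by simp
qed

text \<open>Only for positive t: in Isabelle \<open>0 powr 0 = 0\<close>, so the partial sum lacks its constant term at 0.\<close>

lemma Volterra_iteration_bound:
  fixes f :: "real \<Rightarrow> complex" and z :: complex
  assumes \<alpha>: "0 < \<alpha>" and cont: "continuous_on {0..T} f"
    and eq: "\<And>t. 0 < t \<Longrightarrow> t \<le> T \<Longrightarrow>
      f t - f 0 = z / complex_of_real (Gamma \<alpha>) * (LBINT s:{0<..<t}. (t - s) powr (\<alpha> - 1) *\<^sub>R f s)"
    and M: "\<And>t. t \<in> {0..T} \<Longrightarrow> norm (f t) \<le> M"
    and t: "0 < t" "t \<le> T"
  shows "norm (f t - f 0 * (\<Sum>k<n. z ^ k * of_real (t powr (\<alpha> * real k) / Gamma (\<alpha> * real k + 1))))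
      \<le> M * (cmod z ^ n * (t powr (\<alpha> * real n) / Gamma (\<alpha> * real n + 1)))"
  using t
proof (induction n arbitrary: t)
  case 0
  thus ?case using M[of t] by simp
next
  case (Suc n)
  define S where "S = (\<lambda>n t. \<Sum>k<n. z ^ k * complex_of_real (t powr (\<alpha> * real k) / Gamma (\<alpha> * real k + 1)))"
  define K where "K = (\<lambda>s. indicator {0<..<t} s * (t - s) powr (\<alpha> - 1))"
  define m where "m = (\<lambda>k s. s powr (\<alpha> * real k) / Gamma (\<alpha> * real k + 1))"
  have G: "Gamma \<alpha> > 0" using \<alpha> by (rule Gamma_real_pos)
  have Km: "has_bochner_integral lborel (\<lambda>s. K s * m k s) (Gamma \<alpha> * m (Suc k) t)" for k
    using has_bochner_integral_Abel_powr[OF \<alpha> Suc.prems(1), of k] by (simp add: K_def m_def mult_ac)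
  have "has_bochner_integral lborel (\<lambda>s. f 0 * (\<Sum>k<n. z ^ k * complex_of_real (K s * m k s)))
      (f 0 * (\<Sum>k<n. z ^ k * of_real (Gamma \<alpha> * m (Suc k) t)))"
    by (intro has_bochner_integral_mult_right has_bochner_integral_sum
        has_bochner_integral_bounded_linear[OF bounded_linear_of_real] Km)
  also have "(\<lambda>s. f 0 * (\<Sum>k<n. z ^ k * complex_of_real (K s * m k s))) = (\<lambda>s. K s *\<^sub>R (f 0 * S n s))"
    by (simp add: S_def m_def fun_eq_iff scaleR_conv_of_real sum_distrib_left mult_ac)
  finally have KS: "has_bochner_integral lborel (\<lambda>s. K s *\<^sub>R (f 0 * S n s))
      (f 0 * (\<Sum>k<n. z ^ k * of_real (Gamma \<alpha> * m (Suc k) t)))" .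
  have Kf: "has_bochner_integral lborel (\<lambda>s. K s *\<^sub>R f s)
      (LBINT s:{0<..<t}. (t - s) powr (\<alpha> - 1) *\<^sub>R f s)"
    using set_integrable_Abel_kernel[OF \<alpha> Suc.prems(1) continuous_on_subset[OF cont]] Suc.prems
    by (simp add: has_bochner_integral_iff K_def set_integrable_def set_lebesgue_integral_def)
  \<comment> \<open>Since \<open>m k\<close> is sent to \<open>Gamma \<alpha> * m (Suc k)\<close>,
    integrating the n-th remainder against the kernel and multiplying by z / \<Gamma>(\<alpha>)
    gives the next remainder.\<close>
  have diff: "has_bochner_integral lborel (\<lambda>s. K s *\<^sub>R (f s - f 0 * S n s))
      ((LBINT s:{0<..<t}. (t - s) powr (\<alpha> - 1) *\<^sub>R f s)
        - f 0 * (\<Sum>k<n. z ^ k * of_real (Gamma \<alpha> * m (Suc k) t)))"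
    using has_bochner_integral_diff[OF Kf KS] by (simp add: scaleR_diff_right)
  have bound: "has_bochner_integral lborel (\<lambda>s. M * (cmod z ^ n * (K s * m n s)))
      (M * (cmod z ^ n * (Gamma \<alpha> * m (Suc n) t)))"
    by (intro has_bochner_integral_mult_right Km)
  \<comment> \<open>The induction hypothesis is needed at every s in (0,t), hence the generalisation
    over t; elsewhere \<open>K\<close> vanishes.\<close>
  have le: "norm (K s *\<^sub>R (f s - f 0 * S n s)) \<le> M * (cmod z ^ n * (K s * m n s))" for s
  proof (cases "s \<in> {0<..<t}")
    case True
    hence "K s * norm (f s - f 0 * S n s) \<le> K s * (M * (cmod z ^ n * m n s))"
      using Suc.IH[of s] Suc.prems by (intro mult_left_mono) (auto simp: K_def S_def m_def)
    moreover have "K s \<ge> 0" by (simp add: K_def)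
    ultimately show ?thesis by (simp add: mult_ac)
  qed (simp add: K_def)
  have "S (Suc n) t = 1 + (\<Sum>k<n. z ^ Suc k * of_real (m (Suc k) t))"
    using Suc.prems by (simp add: S_def m_def sum.lessThan_Suc_shift del: sum.lessThan_Suc power_Suc of_nat_Suc)
  hence "f t - f 0 * S (Suc n) t = (f t - f 0) - f 0 * z * (\<Sum>k<n. z ^ k * of_real (m (Suc k) t))"
    by (simp add: algebra_simps sum_distrib_left)
  also have "\<dots> = z / complex_of_real (Gamma \<alpha>) * (LBINT s. K s *\<^sub>R (f s - f 0 * S n s))"
  proof -
    have "(\<Sum>k<n. z ^ k * complex_of_real (Gamma \<alpha> * m (Suc k) t)) =
        complex_of_real (Gamma \<alpha>) * (\<Sum>k<n. z ^ k * of_real (m (Suc k) t))"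
      by (simp add: sum_distrib_left mult_ac del: of_nat_Suc)
    moreover have "complex_of_real (Gamma \<alpha>) \<noteq> 0" using G by simp
    ultimately show ?thesis
      unfolding eq[OF Suc.prems] has_bochner_integral_integral_eq[OF diff]
      by (simp add: right_diff_distrib)
  qed
  finally have "norm (f t - f 0 * S (Suc n) t) =
      cmod z / Gamma \<alpha> * norm (LBINT s. K s *\<^sub>R (f s - f 0 * S n s))"
    using G by (simp add: norm_mult norm_divide)
  also have "\<dots> \<le> cmod z / Gamma \<alpha> * (M * (cmod z ^ n * (Gamma \<alpha> * m (Suc n) t)))"
  proof (rule mult_left_mono)
    show "norm (LBINT s. K s *\<^sub>R (f s - f 0 * S n s)) \<le> M * (cmod z ^ n * (Gamma \<alpha> * m (Suc n) t))"
      unfolding has_bochner_integral_integral_eq[OF bound, symmetric]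
      using diff bound le by (intro Bochner_Integration.integral_norm_bound_integral) (auto simp: has_bochner_integral_iff)
  qed (use G in auto)
  also have "\<dots> = M * (cmod z ^ Suc n * m (Suc n) t)"
    using G by simp
  finally show ?case by (simp add: S_def m_def)
qed

lemma mittag_leffler_sums:
  assumes "0 < \<alpha>" "\<alpha> < 1"
  shows "(\<lambda>k. of_real (1 / Gamma (\<alpha> * real k + 1)) * w ^ k) sums mittag_leffler \<alpha> w"
  using summable_sums[OF summable_mittag_leffler[OF assms, of w]]
  by (simp add: mittag_leffler_def)

lemma mittag_leffler_0: "mittag_leffler \<alpha> 0 = 1"
proof -
  have "(\<Sum>k. (0::complex) ^ k / complex_of_real (Gamma (\<alpha> * real k + 1))) =
      (\<Sum>k\<in>{0}. 0 ^ k / complex_of_real (Gamma (\<alpha> * real k + 1)))"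
    by (rule suminf_finite) auto
  thus ?thesis by (simp add: mittag_leffler_def)
qed

lemma powr_of_nat_mult:
  fixes t :: real
  assumes "0 < t"
  shows "(t powr \<alpha>) ^ k = t powr (\<alpha> * real k)"
  using assms by (simp add: powr_realpow[symmetric] powr_powr)

text \<open>For fixed t the solution is bounded on [0,t] by some M, and the iteration bound makes
  the distance to the n-th partial sum at most M times a term of a convergent series. The point t =
  0 is separate because the iteration bound covers only positive times.\<close>

lemma Volterra_solution_unique:
  fixes f :: "real \<Rightarrow> complex" and z :: complex
  assumes \<alpha>: "0 < \<alpha>" "\<alpha> < 1" and cont: "continuous_on {0..} f"
    and eq: "\<And>t. 0 < t \<Longrightarrow>
      f t - f 0 = z / complex_of_real (Gamma \<alpha>) * (LBINT s:{0<..<t}. (t - s) powr (\<alpha> - 1) *\<^sub>R f s)"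
    and t: "0 \<le> t"
  shows "f t = f 0 * mittag_leffler \<alpha> (z * of_real (t powr \<alpha>))"
proof (cases "t = 0")
  case True
  thus ?thesis by (simp add: mittag_leffler_0)
next
  case False
  with t have t: "0 < t" by simp
  have cont': "continuous_on {0..t} f" using cont by (rule continuous_on_subset) auto
  hence "compact (f ` {0..t})" by (intro compact_continuous_image) auto
  then obtain M where M: "\<And>s. s \<in> {0..t} \<Longrightarrow> norm (f s) \<le> M"
    by (meson bounded_iff compact_imp_bounded imageI)
  let ?w = "z * of_real (t powr \<alpha>)"
  let ?r = "\<lambda>n. cmod z ^ n * (t powr (\<alpha> * real n) / Gamma (\<alpha> * real n + 1))"
  let ?S = "\<lambda>n. f 0 * (\<Sum>k<n. z ^ k * of_real (t powr (\<alpha> * real k) / Gamma (\<alpha> * real k + 1)))"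
  have coeff: "of_real (1 / Gamma (\<alpha> * real k + 1)) * ?w ^ k =
      z ^ k * of_real (t powr (\<alpha> * real k) / Gamma (\<alpha> * real k + 1))" for k
    using powr_of_nat_mult[OF t, of \<alpha> k]
    by (simp add: power_mult_distrib flip: of_real_power)
  have "?S \<longlonglongrightarrow> f 0 * mittag_leffler \<alpha> ?w"
    using mittag_leffler_sums[OF \<alpha>, of ?w] unfolding coeff sums_def
    by (rule tendsto_mult_left)
  moreover have "(\<lambda>n. f t - ?S n) \<longlonglongrightarrow> 0"
  proof (rule Lim_null_comparison)
    show "\<forall>\<^sub>F n in sequentially. norm (f t - ?S n) \<le> M * ?r n"
      using Volterra_iteration_bound[OF \<alpha>(1) cont' _ M t] eq by (intro always_eventually) auto
    have "?r = (\<lambda>n. of_real (1 / Gamma (\<alpha> * real n + 1)) * (cmod z * t powr \<alpha>) ^ n)"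
      using powr_of_nat_mult[OF t, of \<alpha>] by (simp add: power_mult_distrib fun_eq_iff)
    hence "?r \<longlonglongrightarrow> 0"
      using summable_LIMSEQ_zero[OF summable_mittag_leffler[OF \<alpha>, of "cmod z * t powr \<alpha>"]]
      by (simp only:)
    thus "(\<lambda>n. M * ?r n) \<longlonglongrightarrow> 0" by (rule tendsto_mult_right_zero)
  qed
  from tendsto_diff[OF tendsto_const[of "f t"] this] have "?S \<longlonglongrightarrow> f t" by simp
  ultimately show ?thesis by (rule LIMSEQ_unique[THEN sym])
qed

section \<open>From the planar Caputo system to a scalar Volterra equation\<close>

lemma caputo_solution_Abel_equation:
  fixes X :: "real \<Rightarrow> real^'n"
  assumes \<alpha>: "0 < \<alpha>" "\<alpha> < 1" and t: "0 < t" and X: "caputo_solution \<alpha> A X"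
  shows "(LBINT s:{0<..<t}. (t - s) powr (\<alpha> - 1) * (A *v X s) $ i) =
    Gamma \<alpha> * (X t $ i - X 0 $ i)"
proof -
  define D where "D = (\<lambda>s. vector_derivative X (at s))"
  from X obtain \<delta> where cont: "continuous_on {0..} X"
    and C1: "X C1_differentiable_on {0<..}"
    and \<delta>: "\<delta> > 0" "set_integrable lborel {0<..\<delta>} D"
    and eq: "\<And>s. s > 0 \<Longrightarrow> caputo_vec \<alpha> X s = A *v X s"
    by (auto simp: caputo_solution_def D_def)
  have X': "(X has_vector_derivative D s) (at s)" if "s > 0" for s
    using C1 that by (simp add: C1_differentiable_on_eq D_def vector_derivative_works)
  have "continuous_on {0<..} D"
    using C1 by (simp add: C1_differentiable_on_eq D_def)
  \<comment> \<open>Integrability up to t is glued from the assumption near 0 and continuity away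
    from 0; for \<delta> > t the second interval is empty and the first already suffices.\<close>
  hence "set_integrable lborel {\<delta>..t} D"
    using \<delta>(1) by (intro borel_integrable_atLeastAtMost') (auto elim: continuous_on_subset)
  from set_integrable_Un[OF \<delta>(2) this] have "set_integrable lborel {0<..<t} D"
    by (rule set_integrable_subset) auto
  hence D: "set_integrable lborel {0<..<t} (\<lambda>s. D s $ i)"
    using integrable_bounded_linear[OF bounded_linear_vec_nth, of lborel _ i]
    by (fastforce simp: set_integrable_def)
  have "(LBINT s:{0<..<t}. (t - s) powr (\<alpha> - 1) * (A *v X s) $ i) =
      (LBINT s:{0<..<t}. (t - s) powr (\<alpha> - 1) * caputo \<alpha> (\<lambda>s. X s $ i) s)"
    by (intro set_lebesgue_integral_cong) (auto simp: caputo_vec_def simp flip: eq)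
  also have "\<dots> = Gamma \<alpha> * (X t $ i - X 0 $ i)"
  proof (rule fractional_integral_caputo[OF \<alpha> t _ _ D])
    show "continuous_on {0..t} (\<lambda>s. X s $ i)"
      by (intro continuous_intros continuous_on_subset[OF cont]) auto
    show "((\<lambda>s. X s $ i) has_real_derivative D s $ i) (at s)" if "0 < s" for s
      using bounded_linear.has_vector_derivative[OF bounded_linear_vec_nth X'[OF that], of i]
      by (simp add: has_real_derivative_iff_has_vector_derivative)
  qed
  finally show ?thesis .
qed

text \<open>On x - iy the matrix acts as multiplication by a + ib. The two real Abel equations are
  therefore the real part and the negated imaginary part of a single complex one.\<close>

lemma caputo_solution_rotation_dilation:
  fixes X :: "real \<Rightarrow> real^2"
  assumes \<alpha>: "0 < \<alpha>" "\<alpha> < 1"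
    and X: "caputo_solution \<alpha> (vector [vector [a, b], vector [- b, a]]) X"
    and t: "0 \<le> t"
  shows "Complex (X t $ 1) (- X t $ 2) =
    Complex (X 0 $ 1) (- X 0 $ 2) * mittag_leffler \<alpha> (Complex a b * of_real (t powr \<alpha>))"
proof -
  let ?A = "vector [vector [a, b], vector [- b, a]] :: real^2^2"
  define Z where "Z = (\<lambda>t. Complex (X t $ 1) (- X t $ 2))"
  have cont: "continuous_on {0..} Z"
    using X unfolding Z_def caputo_solution_def by (auto intro!: continuous_intros)
  have "Z t = Z 0 * mittag_leffler \<alpha> (Complex a b * of_real (t powr \<alpha>))"
  proof (rule Volterra_solution_unique[OF \<alpha> cont _ t])
    fix t :: real assume t: "0 < t"
    define J where "J = (LBINT s:{0<..<t}. (t - s) powr (\<alpha> - 1) *\<^sub>R Z s)"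
    have G: "Gamma \<alpha> > 0" using \<alpha> by (intro Gamma_real_pos) auto
    have int: "set_integrable lborel {0<..<t} (\<lambda>s. (t - s) powr (\<alpha> - 1) *\<^sub>R Z s)"
      by (intro set_integrable_Abel_kernel \<alpha> t continuous_on_subset[OF cont]) auto
    hence "has_bochner_integral lborel
        (\<lambda>s. Complex a b * (indicator {0<..<t} s *\<^sub>R (t - s) powr (\<alpha> - 1) *\<^sub>R Z s)) (Complex a b * J)"
      by (intro has_bochner_integral_mult_right)
        (simp add: has_bochner_integral_iff set_integrable_def set_lebesgue_integral_def J_def)
    note hbi = has_bochner_integral_Re[OF this] has_bochner_integral_Im[OF this]
    have A: "(?A *v X s) $ 1 = Re (Complex a b * Z s)" "(?A *v X s) $ 2 = - Im (Complex a b * Z s)" for s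
      by (simp_all add: matrix_vector_mult_def sum_2 Z_def algebra_simps)
    have "Re (Complex a b * J) = (LBINT s:{0<..<t}. (t - s) powr (\<alpha> - 1) * (?A *v X s) $ 1)"
      unfolding has_bochner_integral_integral_eq[OF hbi(1), symmetric] A set_lebesgue_integral_def
      by (intro Bochner_Integration.integral_cong) (auto simp: algebra_simps)
    moreover have "- Im (Complex a b * J) = (LBINT s:{0<..<t}. (t - s) powr (\<alpha> - 1) * (?A *v X s) $ 2)"
      unfolding has_bochner_integral_integral_eq[OF hbi(2), symmetric] A set_lebesgue_integral_def
        integral_minus[symmetric]
      by (intro Bochner_Integration.integral_cong) (auto simp: algebra_simps)
    ultimately have "Complex a b * J = of_real (Gamma \<alpha>) * (Z t - Z 0)"
      unfolding caputo_solution_Abel_equation[OF \<alpha> t X]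
      by (simp add: complex_eq_iff Z_def algebra_simps)
    thus "Z t - Z 0 = Complex a b / of_real (Gamma \<alpha>) *
        (LBINT s:{0<..<t}. (t - s) powr (\<alpha> - 1) *\<^sub>R Z s)"
      using G by (simp add: J_def[symmetric])
  qed
  thus ?thesis by (simp add: Z_def)
qed

subsection \<open>Derivatives of Mittag-Leffler curves\<close>

text \<open>The two-parameter Mittag-Leffler function with both parameters equal to \<open>\<alpha>\<close>.\<close>

definition mittag_leffler2 :: "real \<Rightarrow> complex \<Rightarrow> complex" where
  "mittag_leffler2 \<alpha> w = (\<Sum>n. of_real (1 / Gamma (\<alpha> * real (Suc n))) * w ^ n)"

text \<open>The factor n + 1 from differentiation cancels in \<Gamma>(\<alpha>(n+1) + 1) =
  \<alpha>(n+1) \<Gamma>(\<alpha>(n+1)) and leaves 1/\<alpha>. So \<open>mittag_leffler2\<close> is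
  \<alpha> times the derivative of the Mittag-Leffler function.\<close>

lemma diffs_mittag_leffler:
  assumes "0 < \<alpha>"
  shows "diffs (\<lambda>k. of_real (1 / Gamma (\<alpha> * real k + 1)) :: complex) n =
    of_real (1 / \<alpha>) * of_real (1 / Gamma (\<alpha> * real (Suc n)))"
proof -
  have "Gamma (\<alpha> * real (Suc n) + 1) = \<alpha> * real (Suc n) * Gamma (\<alpha> * real (Suc n))"
  proof (rule Gamma_plus1)
    have "\<alpha> * real (Suc n) > 0" using assms by simp
    thus "\<alpha> * real (Suc n) \<notin> \<int>\<^sub>\<le>\<^sub>0" by (meson nonpos_Ints_nonpos not_less)
  qed
  hence "real (Suc n) * (1 / Gamma (\<alpha> * real (Suc n) + 1)) = 1 / \<alpha> * (1 / Gamma (\<alpha> * real (Suc n)))"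
    using assms by (simp del: of_nat_Suc)
  from arg_cong[OF this, of complex_of_real] show ?thesis
    by (simp only: diffs_def of_real_mult of_real_of_nat_eq)
qed

lemma summable_mittag_leffler2:
  fixes w :: complex
  assumes "0 < \<alpha>" "\<alpha> < 1"
  shows "summable (\<lambda>n. of_real (1 / Gamma (\<alpha> * real (Suc n))) * w ^ n)"
proof -
  have "summable (\<lambda>n. diffs (\<lambda>k. of_real (1 / Gamma (\<alpha> * real k + 1)) :: complex) n * w ^ n)"
    by (intro termdiff_converges_all summable_mittag_leffler assms)
  hence "summable (\<lambda>n. complex_of_real (1 / \<alpha>) * (of_real (1 / Gamma (\<alpha> * real (Suc n))) * w ^ n))"
    unfolding diffs_mittag_leffler[OF assms(1)] by (simp only: mult.assoc)
  thus ?thesis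
    using assms(1) by (subst (asm) summable_cmult_iff) auto
qed

lemma has_field_derivative_mittag_leffler:
  assumes "0 < \<alpha>" "\<alpha> < 1"
  shows "(mittag_leffler \<alpha> has_field_derivative mittag_leffler2 \<alpha> w / of_real \<alpha>) (at w)"
proof -
  have "mittag_leffler \<alpha> = (\<lambda>w. \<Sum>k. of_real (1 / Gamma (\<alpha> * real k + 1)) * w ^ k)"
    by (rule ext) (rule sums_unique[OF mittag_leffler_sums[OF assms]])
  moreover have "(\<Sum>n. diffs (\<lambda>k. of_real (1 / Gamma (\<alpha> * real k + 1)) :: complex) n * w ^ n)
      = mittag_leffler2 \<alpha> w / of_real \<alpha>"
    unfolding diffs_mittag_leffler[OF assms(1)] mult.assoc mittag_leffler2_def
    by (subst suminf_mult[OF summable_mittag_leffler2[OF assms]]) simp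
  ultimately show ?thesis
    using termdiffs_strong_converges_everywhere[OF summable_mittag_leffler[OF assms], of w]
    by (simp only:)
qed

text \<open>The series is given for w L instead of L: this keeps the exponent n, so it can be added
  termwise to the series of \<open>mittag_leffler2\<close> when the velocity is
  differentiated.\<close>

lemma has_field_derivative_mittag_leffler2:
  assumes "0 < \<alpha>" "\<alpha> < 1"
  obtains L where "(mittag_leffler2 \<alpha> has_field_derivative L) (at w)"
    and "(\<lambda>n. of_nat n * (of_real (1 / Gamma (\<alpha> * real (Suc n))) * w ^ n)) sums (w * L)"
proof -
  define c where "c = (\<lambda>n. complex_of_real (1 / Gamma (\<alpha> * real (Suc n))))"
  have sum: "summable (\<lambda>n. c n * w ^ n)" for w
    unfolding c_def by (rule summable_mittag_leffler2[OF assms])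
  define L where "L = (\<Sum>n. diffs c n * w ^ n)"
  have "(mittag_leffler2 \<alpha> has_field_derivative L) (at w)"
    using termdiffs_strong_converges_everywhere[OF sum, of w]
    by (simp add: L_def c_def mittag_leffler2_def[abs_def])
  moreover have "(\<lambda>n. w * (of_nat n * c n * w ^ (n - Suc 0))) sums (w * L)"
    unfolding L_def by (intro sums_mult diffs_equiv termdiff_converges_all sum)
  moreover have "w * (of_nat n * c n * w ^ (n - Suc 0)) = of_nat n * (c n * w ^ n)" for n
    by (cases n) auto
  ultimately show ?thesis using that[of L] unfolding c_def by (simp only:)
qed

lemma has_vector_derivative_of_real_powr:
  fixes t :: real
  assumes "0 < t"
  shows "((\<lambda>t. complex_of_real (t powr \<beta>)) has_vector_derivative of_real (\<beta> * t powr (\<beta> - 1))) (at t)"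
proof -
  have "((\<lambda>t. t powr \<beta>) has_real_derivative \<beta> * t powr (\<beta> - 1)) (at t)"
    using assms by (rule has_real_derivative_powr)
  thus ?thesis
    by (intro bounded_linear.has_vector_derivative[OF bounded_linear_of_real])
       (simp add: has_real_derivative_iff_has_vector_derivative)
qed

text \<open>The time derivative of E_\<alpha>(z t^\<alpha>): the chain-rule factor \<alpha>
  t^(\<alpha>-1) absorbs the 1/\<alpha> above. For t > 0 its real and imaginary parts are c_\<alpha>
  and s_\<alpha>.\<close>

definition mittag_leffler_velocity :: "real \<Rightarrow> complex \<Rightarrow> real \<Rightarrow> complex" where
  "mittag_leffler_velocity \<alpha> z t =
     z * of_real (t powr (\<alpha> - 1)) * mittag_leffler2 \<alpha> (z * of_real (t powr \<alpha>))"

lemma mittag_leffler_curve_derivative: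
  assumes "0 < \<alpha>" "\<alpha> < 1" "0 < t"
  shows "((\<lambda>t. mittag_leffler \<alpha> (z * of_real (t powr \<alpha>))) has_vector_derivative
    mittag_leffler_velocity \<alpha> z t) (at t)"
proof -
  have "((\<lambda>t. z * complex_of_real (t powr \<alpha>)) has_vector_derivative
      z * of_real (\<alpha> * t powr (\<alpha> - 1))) (at t)"
    by (intro has_vector_derivative_mult_right has_vector_derivative_of_real_powr assms)
  from field_vector_diff_chain_at[OF this has_field_derivative_mittag_leffler[OF assms(1,2)]]
  show ?thesis
    using assms by (simp add: o_def mittag_leffler_velocity_def mult_ac)
qed

lemma mittag_leffler_velocity_sums:
  assumes "0 < \<alpha>" "\<alpha> < 1" "0 < t"
  shows "(\<lambda>n. of_real (t powr (\<alpha> * real (Suc n) - 1) / Gamma (\<alpha> * real (Suc n))) * z ^ Suc n)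
    sums mittag_leffler_velocity \<alpha> z t"
proof -
  let ?w = "z * complex_of_real (t powr \<alpha>)"
  have "(\<lambda>n. z * complex_of_real (t powr (\<alpha> - 1)) * (of_real (1 / Gamma (\<alpha> * real (Suc n))) * ?w ^ n))
      sums mittag_leffler_velocity \<alpha> z t"
    unfolding mittag_leffler_velocity_def mittag_leffler2_def
    by (intro sums_mult summable_sums summable_mittag_leffler2 assms)
  moreover have "z * complex_of_real (t powr (\<alpha> - 1)) * (of_real (1 / Gamma (\<alpha> * real (Suc n))) * ?w ^ n)
      = of_real (t powr (\<alpha> * real (Suc n) - 1) / Gamma (\<alpha> * real (Suc n))) * z ^ Suc n" for n
  proof -
    have "t powr (\<alpha> * real (Suc n) - 1) = t powr (\<alpha> - 1) * (t powr \<alpha>) ^ n"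
      using assms by (simp add: powr_of_nat_mult algebra_simps flip: powr_add)
    thus ?thesis by (simp add: power_mult_distrib)
  qed
  ultimately show ?thesis by (simp only:)
qed

lemma mittag_leffler_velocity_derivative:
  assumes "0 < \<alpha>" "\<alpha> < 1" "0 < t"
  obtains L where "(mittag_leffler_velocity \<alpha> z has_vector_derivative L) (at t)"
    and "(\<lambda>n. of_real ((\<alpha> * real (Suc n) - 1) * t powr (\<alpha> * real (Suc n) - 2)
            / Gamma (\<alpha> * real (Suc n))) * z ^ Suc n) sums L"
proof -
  let ?w = "z * complex_of_real (t powr \<alpha>)"
  let ?c = "\<lambda>n. of_real (1 / Gamma (\<alpha> * real (Suc n))) * ?w ^ n"
  obtain K where K: "(mittag_leffler2 \<alpha> has_field_derivative K) (at ?w)"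
      "(\<lambda>n. of_nat n * ?c n) sums (?w * K)"
    using has_field_derivative_mittag_leffler2[OF assms(1,2)] by blast
  define L where "L = z * of_real (t powr (\<alpha> - 2)) *
      (of_real (\<alpha> - 1) * mittag_leffler2 \<alpha> ?w + of_real \<alpha> * (?w * K))"
  \<comment> \<open>The product rule yields two factors t^(\<alpha>-1), whereas \<open>L\<close>
    carries t^(\<alpha>-2) and the t^\<alpha> contained in \<open>?w\<close>.\<close>
  have pw: "t powr (\<alpha> - 2) * t powr \<alpha> = t powr (\<alpha> - 1) * t powr (\<alpha> - 1)"
    by (simp flip: powr_add)
  have "((\<lambda>t. z * complex_of_real (t powr \<alpha>)) has_vector_derivative
      z * of_real (\<alpha> * t powr (\<alpha> - 1))) (at t)"
    by (intro has_vector_derivative_mult_right has_vector_derivative_of_real_powr assms)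
  from field_vector_diff_chain_at[OF this K(1)]
  have "((\<lambda>t. mittag_leffler2 \<alpha> (z * of_real (t powr \<alpha>))) has_vector_derivative
      z * of_real (\<alpha> * t powr (\<alpha> - 1)) * K) (at t)"
    by (simp add: o_def)
  moreover have "((\<lambda>t. z * complex_of_real (t powr (\<alpha> - 1))) has_vector_derivative
      z * of_real ((\<alpha> - 1) * t powr (\<alpha> - 1 - 1))) (at t)"
    by (intro has_vector_derivative_mult_right has_vector_derivative_of_real_powr assms)
  ultimately have "(mittag_leffler_velocity \<alpha> z has_vector_derivative
      (z * complex_of_real (t powr (\<alpha> - 1))) * (z * of_real (\<alpha> * t powr (\<alpha> - 1)) * K) +
      z * of_real ((\<alpha> - 1) * t powr (\<alpha> - 1 - 1)) * mittag_leffler2 \<alpha> ?w) (at t)"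
    unfolding mittag_leffler_velocity_def[abs_def] by (intro has_vector_derivative_mult)
  also have "(z * complex_of_real (t powr (\<alpha> - 1))) * (z * of_real (\<alpha> * t powr (\<alpha> - 1)) * K) +
      z * of_real ((\<alpha> - 1) * t powr (\<alpha> - 1 - 1)) * mittag_leffler2 \<alpha> ?w =
      z * z * of_real \<alpha> * K * of_real (t powr (\<alpha> - 1) * t powr (\<alpha> - 1)) +
      z * of_real (t powr (\<alpha> - 2)) * (of_real (\<alpha> - 1) * mittag_leffler2 \<alpha> ?w)"
    by (simp add: mult_ac)
  also have "\<dots> = L"
    unfolding pw[symmetric] by (simp add: L_def algebra_simps)
  finally have "(mittag_leffler_velocity \<alpha> z has_vector_derivative L) (at t)" .
  moreover have "(\<lambda>n. z * of_real (t powr (\<alpha> - 2)) * (of_real (\<alpha> - 1) * ?c n + of_real \<alpha> * (of_nat n * ?c n))) sums L"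
    unfolding L_def mittag_leffler2_def
    by (intro sums_mult sums_add K(2) summable_sums summable_mittag_leffler2 assms)
  moreover have "z * of_real (t powr (\<alpha> - 2)) * (of_real (\<alpha> - 1) * ?c n + of_real \<alpha> * (of_nat n * ?c n)) =
      of_real ((\<alpha> * real (Suc n) - 1) * t powr (\<alpha> * real (Suc n) - 2) / Gamma (\<alpha> * real (Suc n))) * z ^ Suc n" for n
  proof -
    have "t powr (\<alpha> * real (Suc n) - 2) = t powr (\<alpha> - 2) * (t powr \<alpha>) ^ n"
      using assms by (simp add: powr_of_nat_mult algebra_simps flip: powr_add)
    hence "of_real ((\<alpha> * real (Suc n) - 1) * t powr (\<alpha> * real (Suc n) - 2) / Gamma (\<alpha> * real (Suc n))) * z ^ Suc n
        = z * of_real (t powr (\<alpha> - 2)) * (of_real (\<alpha> * real (Suc n) - 1) * ?c n)"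
      by (simp add: power_mult_distrib mult_ac del: of_nat_Suc)
    \<comment> \<open>The exponent splits as (\<alpha> - 1) + \<alpha> n: the first part stems from
      the prefactor t^(\<alpha>-1), the second from the power series.\<close>
    also have "of_real (\<alpha> * real (Suc n) - 1) * ?c n = of_real (\<alpha> - 1) * ?c n + of_real \<alpha> * (of_nat n * ?c n)"
      by (simp add: ring_distribs del: of_real_divide)
    finally show ?thesis by simp
  qed
  ultimately show ?thesis using that by (simp only:)
qed

lemma Re_Im_of_real_mult: "Re (of_real r * y) = Re y * r" "Im (of_real r * y) = Im y * r"
  by simp_all

lemma c_series_eq:
  assumes "0 < \<alpha>" "\<alpha> < 1" "0 < t"
  shows "c_series \<alpha> z t = Re (mittag_leffler_velocity \<alpha> z t)"
  using sums_unique[OF sums_Re[OF mittag_leffler_velocity_sums[OF assms, of z]]]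
  by (simp only: c_series_def Re_Im_of_real_mult times_divide_eq_right)

lemma s_series_eq:
  assumes "0 < \<alpha>" "\<alpha> < 1" "0 < t"
  shows "s_series \<alpha> z t = Im (mittag_leffler_velocity \<alpha> z t)"
  using sums_unique[OF sums_Im[OF mittag_leffler_velocity_sums[OF assms, of z]]]
  by (simp only: s_series_def Re_Im_of_real_mult times_divide_eq_right)

text \<open>With V = c_\<alpha> + i s_\<alpha>, the bracket in \<open>u3\<close> is s c' - c s', the
  negated imaginary part of conj(V) V'; the two extra series are the parts of V'.\<close>

lemma u3_eq:
  assumes "0 < \<alpha>" "\<alpha> < 1" "0 < t"
  shows "u3 \<alpha> z c1 c2 t = (c1\<^sup>2 + c2\<^sup>2) * - Im (cnj (mittag_leffler_velocity \<alpha> z t) *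
    vector_derivative (mittag_leffler_velocity \<alpha> z) (at t))"
proof -
  obtain L where L: "(mittag_leffler_velocity \<alpha> z has_vector_derivative L) (at t)"
    "(\<lambda>n. of_real ((\<alpha> * real (Suc n) - 1) * t powr (\<alpha> * real (Suc n) - 2)
            / Gamma (\<alpha> * real (Suc n))) * z ^ Suc n) sums L"
    using mittag_leffler_velocity_derivative[OF assms] by blast
  have "(\<Sum>n. Re (z ^ Suc n) * (\<alpha> * real (Suc n) - 1) * t powr (\<alpha> * real (Suc n) - 2)
      / Gamma (\<alpha> * real (Suc n))) = Re L"
    using sums_unique[OF sums_Re[OF L(2)]]
    by (simp only: Re_Im_of_real_mult times_divide_eq_right mult.assoc)
  moreover have "(\<Sum>n. Im (z ^ Suc n) * (\<alpha> * real (Suc n) - 1) * t powr (\<alpha> * real (Suc n) - 2)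
      / Gamma (\<alpha> * real (Suc n))) = Im L"
    using sums_unique[OF sums_Im[OF L(2)]]
    by (simp only: Re_Im_of_real_mult times_divide_eq_right mult.assoc)
  ultimately show ?thesis
    unfolding u3_def vector_derivative_at[OF L(1)]
    using assms by (simp add: c_series_eq s_series_eq algebra_simps)
qed

section \<open>Plane geometry of the conjugated curve C E_\<alpha>(z t^\<alpha>)\<close>

lemma has_real_derivative_Re_Im_mult:
  fixes g :: "real \<Rightarrow> complex"
  assumes "(g has_vector_derivative g') (at t)"
  shows "((\<lambda>s. Re (C * g s)) has_real_derivative Re (C * g')) (at t)"
    and "((\<lambda>s. - Im (C * g s)) has_real_derivative - Im (C * g')) (at t)"
proof -
  have "((\<lambda>s. C * g s) has_vector_derivative C * g') (at t)"
    using assms by (rule has_vector_derivative_mult_right)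
  note * = bounded_linear.has_vector_derivative[OF bounded_linear_Re this]
    bounded_linear.has_vector_derivative[OF bounded_linear_Im this]
  show "((\<lambda>s. Re (C * g s)) has_real_derivative Re (C * g')) (at t)"
    and "((\<lambda>s. - Im (C * g s)) has_real_derivative - Im (C * g')) (at t)"
    unfolding has_real_derivative_iff_has_vector_derivative
    by (rule *, intro has_vector_derivative_minus *)
qed

lemma mittag_leffler_curve_derivs:
  fixes \<alpha> :: real and z C :: complex and X :: "real \<Rightarrow> real^2"
  defines "V \<equiv> mittag_leffler_velocity \<alpha> z"
  assumes \<alpha>: "0 < \<alpha>" "\<alpha> < 1"
    and X: "\<forall>t>0. Complex (X t $ 1) (- X t $ 2) = C * mittag_leffler \<alpha> (z * of_real (t powr \<alpha>))"
  shows "0 < t \<Longrightarrow> deriv (\<lambda>s. X s $ 1) t = Re (C * V t)"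
    and "0 < t \<Longrightarrow> deriv (\<lambda>s. X s $ 2) t = - Im (C * V t)"
    and "0 < t \<Longrightarrow> deriv (deriv (\<lambda>s. X s $ 1)) t = Re (C * vector_derivative V (at t))"
    and "0 < t \<Longrightarrow> deriv (deriv (\<lambda>s. X s $ 2)) t = - Im (C * vector_derivative V (at t))"
    and "twice_differentiable_curve X"
proof -
  have comps: "X t $ 1 = Re (C * mittag_leffler \<alpha> (z * of_real (t powr \<alpha>)))"
    "X t $ 2 = - Im (C * mittag_leffler \<alpha> (z * of_real (t powr \<alpha>)))" if "0 < t" for t
    unfolding X[rule_format, OF that, symmetric] by simp_all
  have d: "((\<lambda>s. X s $ 1) has_real_derivative Re (C * V t)) (at t)"
    "((\<lambda>s. X s $ 2) has_real_derivative - Im (C * V t)) (at t)" if "0 < t" for t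
    unfolding V_def
    by (rule has_field_derivative_transform_within_open[OF
          has_real_derivative_Re_Im_mult(1)[OF mittag_leffler_curve_derivative[OF \<alpha> that]],
          of "{0<..}"];
        use that comps in simp)
      (rule has_field_derivative_transform_within_open[OF
          has_real_derivative_Re_Im_mult(2)[OF mittag_leffler_curve_derivative[OF \<alpha> that]],
          of "{0<..}"];
        use that comps in simp)
  have V': "(V has_vector_derivative vector_derivative V (at t)) (at t)" if t: "0 < t" for t
  proof -
    obtain L where "(V has_vector_derivative L) (at t)"
      unfolding V_def by (rule mittag_leffler_velocity_derivative[OF \<alpha> t])
    thus ?thesis by (simp add: vector_derivative_at)
  qed
  \<comment> \<open>\<open>deriv\<close> has a known value only at positive times; agreement on the
    open half-line is enough to differentiate it once more.\<close>
  have dd: "(deriv (\<lambda>s. X s $ 1) has_real_derivative Re (C * vector_derivative V (at t))) (at t)"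
    "(deriv (\<lambda>s. X s $ 2) has_real_derivative - Im (C * vector_derivative V (at t))) (at t)"
    if "0 < t" for t
    by (rule has_field_derivative_transform_within_open[OF
          has_real_derivative_Re_Im_mult(1)[OF V'[OF that]], of "{0<..}"];
        use that d[THEN DERIV_imp_deriv] in simp)
      (rule has_field_derivative_transform_within_open[OF
          has_real_derivative_Re_Im_mult(2)[OF V'[OF that]], of "{0<..}"];
        use that d[THEN DERIV_imp_deriv] in simp)
  show "0 < t \<Longrightarrow> deriv (\<lambda>s. X s $ 1) t = Re (C * V t)"
    "0 < t \<Longrightarrow> deriv (\<lambda>s. X s $ 2) t = - Im (C * V t)"
    "0 < t \<Longrightarrow> deriv (deriv (\<lambda>s. X s $ 1)) t = Re (C * vector_derivative V (at t))"
    "0 < t \<Longrightarrow> deriv (deriv (\<lambda>s. X s $ 2)) t = - Im (C * vector_derivative V (at t))"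
    using d dd by (auto intro: DERIV_imp_deriv)
  show "twice_differentiable_curve X"
    unfolding twice_differentiable_curve_def forall_2 real_differentiable_def using d dd by blast
qed

text \<open>Keeping the constant C arbitrary lets the same statement serve both curves.
  Multiplication by C is a similarity, so speed scales by |C| and the curvature determinant by
  |C|^2.\<close>

lemma mittag_leffler_curve_geometry:
  fixes \<alpha> :: real and z C :: complex and X :: "real \<Rightarrow> real^2"
  defines "V \<equiv> mittag_leffler_velocity \<alpha> z"
  assumes \<alpha>: "0 < \<alpha>" "\<alpha> < 1"
    and X: "\<forall>t>0. Complex (X t $ 1) (- X t $ 2) = C * mittag_leffler \<alpha> (z * of_real (t powr \<alpha>))"
    and t: "0 < t"
  shows "speed X t = cmod C * cmod (V t)"
    and "unit_tangent X t = (1 / speed X t) *\<^sub>R vector [Re (C * V t), - Im (C * V t)]"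
    and "unit_normal X t = (1 / speed X t) *\<^sub>R vector [Im (C * V t), Re (C * V t)]"
    and "curvature X t =
      (cmod C)\<^sup>2 * \<bar>Im (cnj (V t) * vector_derivative V (at t))\<bar> / speed X t ^ 3"
proof -
  note d = mittag_leffler_curve_derivs[OF \<alpha> X, folded V_def]
  show "speed X t = cmod C * cmod (V t)"
    unfolding speed_def d(1,2)[OF t] norm_mult[symmetric] by (simp only: cmod_def power2_minus)
  show "unit_tangent X t = (1 / speed X t) *\<^sub>R vector [Re (C * V t), - Im (C * V t)]"
    "unit_normal X t = (1 / speed X t) *\<^sub>R vector [Im (C * V t), Re (C * V t)]"
    unfolding unit_tangent_def unit_normal_def d(1,2)[OF t] by (simp_all only: minus_minus)
  \<comment> \<open>This determinant is -Im(conj(C V) C W), and conj(C) C = |C|^2; the minus sign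
    reflects the conjugation of the curve.\<close>
  have "Re (C * V t) * - Im (C * W) - - Im (C * V t) * Re (C * W) = - ((cmod C)\<^sup>2 * Im (cnj (V t) * W))" for W
    unfolding cmod_power2 by (simp add: power2_eq_square algebra_simps)
  thus "curvature X t =
      (cmod C)\<^sup>2 * \<bar>Im (cnj (V t) * vector_derivative V (at t))\<bar> / speed X t ^ 3"
    unfolding curvature_def d(1-4)[OF t] by (simp add: abs_mult)
qed

section \<open>Comparison of the two curves\<close>

theorem mainTheorem4:
  fixes \<alpha> a b c1 c2 t1 p q :: real
    and z w :: complex
    and A :: "real^2^2"
    and X Y :: "real \<Rightarrow> real^2"
  assumes "0 < \<alpha>" and "\<alpha> < 1" and "0 < t1"
    and A: "A = vector [vector [a, b], vector [- b, a]]"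
    and X: "caputo_solution \<alpha> A X" "X 0 = vector [c1, c2]"
    and Y: "caputo_solution \<alpha> A Y" "Y 0 = X t1"
    and z: "z = Complex a b"
    and w: "w = mittag_leffler \<alpha> (z * complex_of_real (t1 powr \<alpha>))"
    and p: "p = c1 * Re w + c2 * Im w"
    and q: "q = - c1 * Im w + c2 * Re w"
  shows "(\<forall>t\<ge>0. let E = mittag_leffler \<alpha> (z * complex_of_real (t powr \<alpha>)) in
            X t = vector [c1 * Re E + c2 * Im E, - c1 * Im E + c2 * Re E] \<and>
            Y t = vector [p * Re E + q * Im E, - p * Im E + q * Re E]) \<and>
         twice_differentiable_curve X \<and> twice_differentiable_curve Y \<and>
         (\<forall>t>0.
            speed X t = sqrt (c1\<^sup>2 + c2\<^sup>2) * sqrt ((c_series \<alpha> z t)\<^sup>2 + (s_series \<alpha> z t)\<^sup>2) \<and>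
            speed Y t = sqrt (c1\<^sup>2 + c2\<^sup>2) * cmod w *
                          sqrt ((c_series \<alpha> z t)\<^sup>2 + (s_series \<alpha> z t)\<^sup>2) \<and>
            speed Y t = cmod w * speed X t) \<and>
         (\<forall>t>0. speed X t \<noteq> 0 \<and> speed Y t \<noteq> 0 \<longrightarrow>
            curvature X t = \<bar>u3 \<alpha> z c1 c2 t / speed X t ^ 3\<bar> \<and>
            curvature Y t = 1 / cmod w * curvature X t \<and>
            unit_tangent X t = (1 / speed X t) *\<^sub>R
              vector [c1 * c_series \<alpha> z t + c2 * s_series \<alpha> z t,
                      - c1 * s_series \<alpha> z t + c2 * c_series \<alpha> z t] \<and>
            unit_normal X t = (1 / speed X t) *\<^sub>R
              vector [c1 * s_series \<alpha> z t - c2 * c_series \<alpha> z t,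
                      c1 * c_series \<alpha> z t + c2 * s_series \<alpha> z t] \<and>
            unit_tangent Y t = (Re w * speed X t / speed Y t) *\<^sub>R unit_tangent X t
                             - (Im w * speed X t / speed Y t) *\<^sub>R unit_normal X t \<and>
            unit_normal Y t = (Re w * speed X t / speed Y t) *\<^sub>R unit_normal X t
                            + (Im w * speed X t / speed Y t) *\<^sub>R unit_tangent X t)"
proof -
  define C where "C = Complex c1 (- c2)"
  let ?E = "\<lambda>t. mittag_leffler \<alpha> (z * complex_of_real (t powr \<alpha>))"
  note \<alpha> = \<open>0 < \<alpha>\<close> \<open>\<alpha> < 1\<close>
  have X_eq: "Complex (X t $ 1) (- X t $ 2) = C * ?E t" if "0 \<le> t" for t
    using caputo_solution_rotation_dilation[OF \<alpha> X(1)[unfolded A] that] by (simp add: X(2) C_def z)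
  \<comment> \<open>The formula for \<open>X\<close> at \<open>t1\<close> gives \<open>C * w\<close>
    as the complex initial value of \<open>Y\<close>; p and -q are its real and imaginary
    parts.\<close>
  have Y_eq: "Complex (Y t $ 1) (- Y t $ 2) = C * w * ?E t" if "0 \<le> t" for t
    using caputo_solution_rotation_dilation[OF \<alpha> Y(1)[unfolded A] that] X_eq[of t1] \<open>0 < t1\<close>
    by (simp add: Y(2) z w)
  have Cw: "C * w = Complex p (- q)"
    by (simp add: C_def p q complex_eq_iff algebra_simps)
  have curves: "X t = vector [c1 * Re E + c2 * Im E, - c1 * Im E + c2 * Re E]"
    "Y t = vector [p * Re E + q * Im E, - p * Im E + q * Re E]" if "0 \<le> t" "E = ?E t" for t E
    using X_eq[OF that(1)] Y_eq[OF that(1)] that(2)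
    unfolding Cw by (auto simp: C_def complex_eq_iff vec_eq_iff forall_2 algebra_simps)
  have X_pos: "\<forall>t>0. Complex (X t $ 1) (- X t $ 2) = C * ?E t"
    and Y_pos: "\<forall>t>0. Complex (Y t $ 1) (- Y t $ 2) = C * w * ?E t"
    using X_eq Y_eq by simp_all
  note twice = mittag_leffler_curve_derivs(5)[OF \<alpha> X_pos] mittag_leffler_curve_derivs(5)[OF \<alpha> Y_pos]
  define V where "V = mittag_leffler_velocity \<alpha> z"
  have cs: "c_series \<alpha> z t = Re (V t)" "s_series \<alpha> z t = Im (V t)" if "0 < t" for t
    using \<alpha> that by (simp_all add: c_series_eq s_series_eq V_def)
  note geoX = mittag_leffler_curve_geometry[OF \<alpha> X_pos, folded V_def]
  note geoY = mittag_leffler_curve_geometry[OF \<alpha> Y_pos, folded V_def]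
  have speeds: "speed X t = sqrt (c1\<^sup>2 + c2\<^sup>2) * sqrt ((c_series \<alpha> z t)\<^sup>2 + (s_series \<alpha> z t)\<^sup>2)"
    "speed Y t = cmod w * speed X t" if "0 < t" for t
    using geoX(1)[OF that] geoY(1)[OF that]
    by (simp_all add: cs[OF that] norm_mult C_def cmod_def[of "V t"] complex_norm)
  have geo: "curvature X t = \<bar>u3 \<alpha> z c1 c2 t / speed X t ^ 3\<bar>"
    "curvature Y t = 1 / cmod w * curvature X t"
    "unit_tangent X t = (1 / speed X t) *\<^sub>R
              vector [c1 * c_series \<alpha> z t + c2 * s_series \<alpha> z t,
                      - c1 * s_series \<alpha> z t + c2 * c_series \<alpha> z t]"
    "unit_normal X t = (1 / speed X t) *\<^sub>R
              vector [c1 * s_series \<alpha> z t - c2 * c_series \<alpha> z t,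
                      c1 * c_series \<alpha> z t + c2 * s_series \<alpha> z t]"
    "unit_tangent Y t = (Re w * speed X t / speed Y t) *\<^sub>R unit_tangent X t
                             - (Im w * speed X t / speed Y t) *\<^sub>R unit_normal X t"
    "unit_normal Y t = (Re w * speed X t / speed Y t) *\<^sub>R unit_normal X t
                            + (Im w * speed X t / speed Y t) *\<^sub>R unit_tangent X t"
    if t: "0 < t" and nz: "speed X t \<noteq> 0" "speed Y t \<noteq> 0" for t
  proof -
    \<comment> \<open>The speed of \<open>Y\<close> has the factor |w|, so its nonvanishing makes
      1/|w| a genuine quotient.\<close>
    have w0: "cmod w \<noteq> 0" using speeds(2)[OF t] nz by auto
    have C2: "(cmod C)\<^sup>2 = c1\<^sup>2 + c2\<^sup>2" by (simp add: C_def cmod_power2)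
    have pos: "speed X t \<ge> 0" by (simp add: speed_def)
    show "curvature X t = \<bar>u3 \<alpha> z c1 c2 t / speed X t ^ 3\<bar>"
      unfolding geoX(4)[OF t] u3_eq[OF \<alpha> t, of z, folded V_def] C2
      by (simp only: abs_divide abs_mult abs_minus_cancel power_abs abs_of_nonneg[OF pos]
          abs_of_nonneg[OF sum_power2_ge_zero])
    \<comment> \<open>The determinant scales by |w|^2 and the cubed speed by |w|^3.\<close>
    show "curvature Y t = 1 / cmod w * curvature X t"
      unfolding geoX(4)[OF t] geoY(4)[OF t] speeds(2)[OF t]
      using w0 nz by (simp add: norm_mult power_mult_distrib field_simps power2_eq_square power3_eq_cube)
    show "unit_tangent X t = (1 / speed X t) *\<^sub>R
              vector [c1 * c_series \<alpha> z t + c2 * s_series \<alpha> z t,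
                      - c1 * s_series \<alpha> z t + c2 * c_series \<alpha> z t]"
      "unit_normal X t = (1 / speed X t) *\<^sub>R
              vector [c1 * s_series \<alpha> z t - c2 * c_series \<alpha> z t,
                      c1 * c_series \<alpha> z t + c2 * s_series \<alpha> z t]"
      unfolding geoX(2,3)[OF t] cs[OF t] by (simp_all add: C_def algebra_simps)
    \<comment> \<open>Multiplying x - iy by w multiplies x + iy by conj(w), which sends T1 to Re w
      T1 - Im w N1 and N1 to Re w N1 + Im w T1. The quotient of the speeds is the normalisation
      1/|w|.\<close>
    show "unit_tangent Y t = (Re w * speed X t / speed Y t) *\<^sub>R unit_tangent X t
                             - (Im w * speed X t / speed Y t) *\<^sub>R unit_normal X t"
      "unit_normal Y t = (Re w * speed X t / speed Y t) *\<^sub>R unit_normal X t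
                            + (Im w * speed X t / speed Y t) *\<^sub>R unit_tangent X t"
      unfolding geoX(2,3)[OF t] geoY(2,3)[OF t]
      using nz by (simp_all add: vec_eq_iff forall_2 field_simps)
  qed
  have "speed Y t = sqrt (c1\<^sup>2 + c2\<^sup>2) * cmod w *
      sqrt ((c_series \<alpha> z t)\<^sup>2 + (s_series \<alpha> z t)\<^sup>2)" if "0 < t" for t
    unfolding speeds(2)[OF that] speeds(1)[OF that] by (simp only: mult_ac)
  with curves twice speeds geo show ?thesis
    unfolding Let_def by (intro conjI allI impI) auto
qed

end
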